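(* The function $z_{\mathrm{BQP}}(\Upsilon)$ is convex in $\log\Upsilon$; that is, the function $\psi\mapsto z_{\mathrm{BQP}}\big((e^{\psi_1},\dots,e^{\psi_n})^\top\big)$ is convex on $\mathbb{R}^n$.
   Context: Let $n>1$, let $s$ be an integer with $0<s<n$, let $C\in\mathbb{R}^{n\times n}$ be a symmetric positive semidefinite matrix with $\operatorname{rank}(C)\ge s$, and let $A\in\mathbb{R}^{m\times n}$, $b\in\mathbb{R}^m$. Notation: $\mathbf{e}$ is the all-ones vector; $\operatorname{ldet}$ is the natural logarithm of the determinant, with value $-\infty$ on singular positive semidefinite matrices; $\mathbb{S}^n$ is the set of real symmetric $n\times n$ matrices; $\operatorname{Diag}(v)$ is the diagonal matrix with diagonal $v$; $\operatorname{diag}(X)$ is the diagonal of $X$ as a vector; $\circ$ is the Hadamard (entrywise) product; $\succeq 0$ means positive semidefinite; $\log$ of a vector is taken componentwise. The maximum over an empty set is $-\infty$ (the constant function $-\infty$ counts as convex). Let $$P(n,s):=\{(x,X)\in\mathbb{R}^n\times\mathbb{S}^n : X-xx^\top\succeq 0,\ \operatorname{diag}(X)=x,\ \mathbf{e}^\top x=s,\ X\mathbf{e}=sx\}.$$ For $\Upsilon=(\gamma_1,\dots,\gamma_n)^\top\in\mathbb{R}^n_{++}$ (all entries positive), $x\in[0,1]^n$ and $X$ symmetric positive semidefinite, let $$f_{\mathrm{BQP}}(x,X;\Upsilon):=\operatorname{ldet}\big((\operatorname{Diag}(\Upsilon)C\operatorname{Diag}(\Upsilon))\circ X+\operatorname{Diag}(\mathbf{e}-x)\big)-2\sum_{i=1}^n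 x_i\log\gamma_i ,$$ and let the g-scaled BQP bound be $$z_{\mathrm{BQP}}(\Upsilon):=\max\{f_{\mathrm{BQP}}(x,X;\Upsilon) : (x,X)\in P(n,s),\ Ax\le b\}.$$ *)

theory Defs
  imports "HOL-Analysis.Analysis"
begin

definition psd :: "real^'n^'n \<Rightarrow> bool" where
  "psd M \<longleftrightarrow> transpose M = M \<and> (\<forall>v. 0 \<le> v \<bullet> (M *v v))"

definition Diag :: "real^'n \<Rightarrow> real^'n^'n" where
  "Diag v = (\<chi> i j. if i = j then v $ i else 0)"

definition hadamard :: "real^'n^'n \<Rightarrow> real^'n^'n \<Rightarrow> real^'n^'n" (infixl "\<circ>\<^sub>H" 70) where
  "M \<circ>\<^sub>H N = (\<chi> i j. M $ i $ j * N $ i $ j)"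

definition outer :: "real^'n \<Rightarrow> real^'n^'n" where
  "outer x = (\<chi> i j. x $ i * x $ j)"

(* Used on positive semidefinite matrices, where det M > 0 holds unless M is singular. *)
definition ldet :: "real^'n^'n \<Rightarrow> ereal" where
  "ldet M = (if det M > 0 then ereal (ln (det M)) else - \<infinity>)"

(* 1 :: real^'n is the all-ones vector. *)
definition P_set :: "nat \<Rightarrow> ((real^'n) \<times> (real^'n^'n)) set" where
  "P_set s = {(x, X). transpose X = X \<and> psd (X - outer x) \<and> (\<forall>i. X $ i $ i = x $ i) \<and>
     1 \<bullet> x = real s \<and> X *v 1 = real s *\<^sub>R x}"

(* The m constraints A x <= b are given by rows, so that m = 0 (no constraint) is included. *)
definition feasible ::
  "nat \<Rightarrow> nat \<Rightarrow> (nat \<Rightarrow> real^'n) \<Rightarrow> (nat \<Rightarrow> real) \<Rightarrow> ((real^'n) \<times> (real^'n^'n)) set" where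
  "feasible s m A b = {(x, X) \<in> P_set s. \<forall>k<m. A k \<bullet> x \<le> b k}"

definition f_BQP :: "real^'n^'n \<Rightarrow> real^'n \<Rightarrow> real^'n^'n \<Rightarrow> real^'n \<Rightarrow> ereal" where
  "f_BQP C x X \<Upsilon> = ldet ((Diag \<Upsilon> ** C ** Diag \<Upsilon>) \<circ>\<^sub>H X + Diag (1 - x))
     - ereal (2 * (\<Sum>i\<in>UNIV. x $ i * ln (\<Upsilon> $ i)))"

(* The supremum is -\<infinity> if nothing is feasible, and a maximum otherwise: see z_BQP_attained. *)
definition z_BQP ::
  "real^'n^'n \<Rightarrow> nat \<Rightarrow> nat \<Rightarrow> (nat \<Rightarrow> real^'n) \<Rightarrow> (nat \<Rightarrow> real) \<Rightarrow> real^'n \<Rightarrow> ereal" where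
  "z_BQP C s m A b \<Upsilon> = (SUP (x, X) \<in> feasible s m A b. f_BQP C x X \<Upsilon>)"

(* Jensen's inequality as in convex_on, for extended real values; ereal has 0 * (-\<infinity>) = 0,
   and \<infinity> + (-\<infinity>) = \<infinity>. *)
definition ereal_convex_on :: "'a::real_vector set \<Rightarrow> ('a \<Rightarrow> ereal) \<Rightarrow> bool" where
  "ereal_convex_on S f \<longleftrightarrow> convex S \<and>
    (\<forall>x\<in>S. \<forall>y\<in>S. \<forall>u\<ge>0. \<forall>v\<ge>0. u + v = 1 \<longrightarrow>
       f (u *\<^sub>R x + v *\<^sub>R y) \<le> ereal u * f x + ereal v * f y)"

lemma quadratic_form_sum:
  "v \<bullet> (M *v v) = (\<Sum>i\<in>UNIV. \<Sum>j\<in>UNIV. v $ i * M $ i $ j * v $ j)"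
  for M :: "real^'n^'n"
  by (simp add: inner_vec_def matrix_vector_mult_def sum_distrib_left mult.assoc)

lemma closed_psd: "closed {M :: real^'n^'n. psd M}"
proof -
  have "{M :: real^'n^'n. psd M} =
    (\<Inter>i. \<Inter>j. {M. M $ j $ i = M $ i $ j}) \<inter> (\<Inter>v. {M. 0 \<le> v \<bullet> (M *v v)})"
    by (auto simp: psd_def transpose_def vec_eq_iff)
  also have "closed \<dots>"
    unfolding quadratic_form_sum
    by (intro closed_Int closed_INT ballI closed_Collect_eq closed_Collect_le continuous_intros)
  finally show ?thesis .
qed

lemma closed_feasible: "closed (feasible s m A b)"
proof -
  have "closed ((\<lambda>p. snd p - outer (fst p)) -` {M. psd M})"
    by (rule closed_vimage[OF closed_psd]) (unfold outer_def, intro continuous_intros)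
  moreover have "feasible s m A b =
    ((\<lambda>p. snd p - outer (fst p)) -` {M. psd M}) \<inter> (\<Inter>i. \<Inter>j. {p. snd p $ j $ i = snd p $ i $ j})
    \<inter> (\<Inter>i. {p. snd p $ i $ i = fst p $ i}) \<inter> {p. 1 \<bullet> fst p = real s}
    \<inter> (\<Inter>i. {p. (\<Sum>j\<in>UNIV. snd p $ i $ j) = real s * fst p $ i})
    \<inter> (\<Inter>k\<in>{..<m}. {p. A k \<bullet> fst p \<le> b k})"
    by (auto simp: feasible_def P_set_def transpose_def vec_eq_iff matrix_vector_mult_def)
  ultimately show ?thesis
    by (auto intro!: closed_Int closed_INT closed_Collect_eq closed_Collect_le continuous_intros)
qed

lemma P_set_bounds:
  assumes "(x, X) \<in> P_set s"
  shows "0 \<le> x $ i" "x $ i \<le> 1" "\<bar>X $ i $ j\<bar> \<le> 1"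
proof -
  define M where "M = X - outer x"
  have M: "\<And>v. 0 \<le> v \<bullet> (M *v v)" "\<And>i j. M $ i $ j = M $ j $ i"
    "\<And>i. X $ i $ i = x $ i" "\<And>i j. M $ i $ j = X $ i $ j - x $ i * x $ j"
    using assms by (auto simp: M_def P_set_def psd_def outer_def transpose_def vec_eq_iff)
  have diag: "0 \<le> x $ i - x $ i * x $ i" for i
    using M(1)[of "axis i 1"] M(3)[of i] M(4)[of i i]
    by (simp add: matrix_vector_mult_basis column_def inner_axis')
  have bnd: "0 \<le> x $ i \<and> x $ i \<le> 1" for i
  proof -
    have "0 \<le> x $ i"
      using diag[of i] by (smt (verit) zero_le_square)
    moreover have "x $ i \<le> 1"
    proof (rule ccontr)
      assume "\<not> x $ i \<le> 1"
      then have "x $ i * 1 < x $ i * x $ i" by (intro mult_strict_left_mono) auto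
      then show False using diag[of i] by simp
    qed
    ultimately show ?thesis ..
  qed
  show "0 \<le> x $ i" "x $ i \<le> 1" using bnd by auto
  have ex: "0 \<le> M $ i $ i + 2 * t * M $ i $ j + t * t * M $ j $ j" for t
  proof -
    have "M *v axis k 1 = (\<chi> l. M $ l $ k)" for k
      by (simp add: matrix_vector_mult_basis column_def)
    then have "(axis i 1 + t *\<^sub>R axis j 1) \<bullet> (M *v (axis i 1 + t *\<^sub>R axis j 1)) =
      M $ i $ i + t * M $ i $ j + t * M $ j $ i + t * t * M $ j $ j"
      by (simp add: matrix_vector_right_distrib matrix_vector_mult_scaleR inner_add_left
          inner_add_right inner_axis' algebra_simps)
    then show ?thesis using M(1)[of "axis i 1 + t *\<^sub>R axis j 1"] M(2)[of j i] by simp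
  qed
  have p: "0 \<le> (x $ i - x $ j)\<^sup>2" "0 \<le> (x $ i + x $ j)\<^sup>2" by simp_all
  have "2 * X $ i $ j \<le> x $ i + x $ j" "- 2 * X $ i $ j \<le> x $ i + x $ j"
    using ex[of "-1"] ex[of 1] p
    by (simp_all add: M(3,4) power2_eq_square algebra_simps)
  then show "\<bar>X $ i $ j\<bar> \<le> 1" using bnd[of i] bnd[of j] by linarith
qed

lemma compact_feasible: "compact (feasible s m (A :: nat \<Rightarrow> real^'n) b)"
proof -
  have "norm (x, X) \<le> CARD('n) + CARD('n) * CARD('n)"
    if "(x, X) \<in> feasible s m A b" for x and X :: "real^'n^'n"
  proof -
    have P: "(x, X) \<in> P_set s" using that by (simp add: feasible_def)
    have "norm x \<le> (\<Sum>i\<in>(UNIV::'n set). \<bar>x $ i\<bar>)" by (rule norm_le_l1_cart)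
    also have "\<dots> \<le> (\<Sum>i\<in>(UNIV::'n set). 1)"
      by (intro sum_mono) (simp add: P_set_bounds[OF P])
    finally have x: "norm x \<le> CARD('n)" by simp
    have "norm (X $ i) \<le> CARD('n)" for i
    proof -
      have "norm (X $ i) \<le> (\<Sum>j\<in>(UNIV::'n set). \<bar>X $ i $ j\<bar>)" by (rule norm_le_l1_cart)
      also have "\<dots> \<le> (\<Sum>j\<in>(UNIV::'n set). 1)"
        by (intro sum_mono P_set_bounds(3)[OF P])
      finally show ?thesis by simp
    qed
    then have "(\<Sum>i\<in>(UNIV::'n set). norm (X $ i)) \<le> (\<Sum>i\<in>(UNIV::'n set). real CARD('n))"
      by (rule sum_mono)
    moreover have "norm X \<le> (\<Sum>i\<in>(UNIV::'n set). norm (X $ i))"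
      by (simp add: norm_vec_def L2_set_le_sum)
    ultimately have X: "norm X \<le> CARD('n) * CARD('n)" by simp
    show ?thesis using norm_Pair_le[of x X] x X by linarith
  qed
  then have "bounded (feasible s m A b)"
    unfolding bounded_iff by (intro exI) auto
  then show ?thesis by (simp add: compact_eq_bounded_closed closed_feasible)
qed

lemma z_BQP_attained:
  fixes A :: "nat \<Rightarrow> real^'n" and \<Upsilon> :: "real^'n"
  assumes "feasible s m A b \<noteq> {}"
  obtains x X where "(x, X) \<in> feasible s m A b" "z_BQP C s m A b \<Upsilon> = f_BQP C x X \<Upsilon>"
proof -
  define L where "L p = 2 * (\<Sum>i\<in>UNIV. fst p $ i * ln (\<Upsilon> $ i))" for p :: "(real^'n) \<times> (real^'n^'n)"
  define D where "D p = det ((Diag \<Upsilon> ** C ** Diag \<Upsilon>) \<circ>\<^sub>H snd p + Diag (1 - fst p))"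
    for p :: "(real^'n) \<times> (real^'n^'n)"
  have Dc: "continuous_on UNIV D"
  proof -
    have ite: "continuous_on UNIV (\<lambda>x :: (real^'n) \<times> (real^'n^'n). if i = j then 1 - fst x $ i else 0)"
      for i j :: 'n
      by (cases "i = j") (auto intro!: continuous_intros)
    show ?thesis
      unfolding D_def det_def hadamard_def Diag_def
      by (simp only: vector_add_component vec_lambda_beta vector_minus_component one_index)
         (intro continuous_intros ite)
  qed
  have "continuous_on (feasible s m A b) (\<lambda>p. D p * exp (- L p))"
    unfolding L_def by (intro continuous_intros continuous_on_subset[OF Dc]) auto
  from continuous_attains_sup[OF compact_feasible assms this]
  obtain p where p: "p \<in> feasible s m A b"
    and max: "\<And>q. q \<in> feasible s m A b \<Longrightarrow> D q * exp (- L q) \<le> D p * exp (- L p)"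
    by blast
  define g where "g q = (if D q > 0 then ereal (ln (D q)) else - \<infinity>) - ereal (L q)" for q
  have g: "f_BQP C (fst q) (snd q) \<Upsilon> = g q" for q
    by (simp add: f_BQP_def ldet_def g_def D_def L_def)
  have "g q \<le> g p" if q: "q \<in> feasible s m A b" for q
  proof (cases "D q > 0")
    case True
    then have "0 < D q * exp (- L q)" by simp
    then have pos: "0 < D p * exp (- L p)" using max[OF q] by linarith
    then have Dp: "D p > 0" by (simp add: zero_less_mult_iff)
    have "ln (D q * exp (- L q)) \<le> ln (D p * exp (- L p))"
      using max[OF q] True pos by (subst ln_le_cancel_iff) auto
    then show ?thesis using True Dp by (simp add: g_def ln_mult)
  qed (simp add: g_def)
  then have "(SUP q \<in> feasible s m A b. g q) = g p"
    using p by (intro antisym SUP_least SUP_upper) auto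
  moreover have "z_BQP C s m A b \<Upsilon> = (SUP q \<in> feasible s m A b. g q)"
    by (simp add: z_BQP_def case_prod_beta g)
  ultimately show thesis using that[of "fst p" "snd p"] p g by simp
qed

end

theory Submission
  imports Defs
begin

text \<open>
  Put \<open>M = C \<circ>\<^sub>H X\<close>, \<open>D = Diag (exp \<psi>)\<close> and \<open>E = Diag (1 - x)\<close>, so that the matrix inside the
  log-determinant is \<open>D M D + E\<close>. Expanding its determinant row by row, and moving the scaling
  out of the rows that come from \<open>D M D\<close>, gives
  \<open>det (D M D + E) = (\<Sum>S. c S * exp (2 * (\<Sum>i\<in>S. \<psi> $ i)))\<close>,
  where \<open>c S\<close> is the determinant of the matrix whose rows are those of \<open>M\<close> on \<open>S\<close> and those of \<open>E\<close>
  elsewhere: a principal minor of \<open>M\<close> times the product of the \<open>1 - x $ i\<close> with \<open>i \<notin> S\<close>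
  (\<open>det_exp_scaled_plus_Diag\<close>). A feasible \<open>X\<close> is positive semidefinite and its \<open>x\<close> has entries at
  most \<open>1\<close>; hence \<open>M\<close> is positive semidefinite by the Schur product theorem
  (\<open>Schur_product_psd\<close>), and \<open>c S \<ge> 0\<close> for all \<open>S\<close> (\<open>det_psd_rows_Diag_rows_nonneg\<close>).

  The logarithm of a nonnegative combination of exponentials of linear functions is convex
  (\<open>sum_exp_log_convex\<close>), and the remaining term of the objective is linear in \<open>\<psi>\<close>. So for each
  feasible \<open>(x, X)\<close> the objective is a convex function of \<open>\<psi>\<close>, or constantly \<open>-\<infinity>\<close> if all \<open>c S\<close>
  vanish. The feasible set does not depend on \<open>\<psi>\<close>, and a supremum of convex functions is convex.
\<close>


section \<open>Expansion of the determinant of a sum\<close>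

text \<open>Distribute the product over the rows in every term of the Leibniz formula.\<close>
lemma det_add_rows:
  fixes A B :: "'a::comm_ring_1^'n^'n"
  shows "det (A + B) = (\<Sum>S\<in>UNIV. det (\<chi> i. if i \<in> S then A $ i else B $ i))"
proof -
  have prod: "(\<Prod>i\<in>UNIV. (A + B) $ i $ p i) =
      (\<Sum>S\<in>UNIV. \<Prod>i\<in>UNIV. (\<chi> i. if i \<in> S then A $ i else B $ i) $ i $ p i)" for p
  proof -
    have "(\<Prod>i\<in>UNIV. (A + B) $ i $ p i) =
        (\<Sum>S\<in>UNIV. (\<Prod>i\<in>S. A $ i $ p i) * (\<Prod>i\<in>UNIV - S. B $ i $ p i))"
      using prod_add[of "UNIV :: 'n set" "\<lambda>i. A $ i $ p i" "\<lambda>i. B $ i $ p i"] by simp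
    also have "\<dots> = (\<Sum>S\<in>UNIV. \<Prod>i\<in>UNIV. (\<chi> i. if i \<in> S then A $ i else B $ i) $ i $ p i)"
    proof (rule sum.cong)
      fix S :: "'n set"
      have "(\<Prod>i\<in>UNIV. (\<chi> i. if i \<in> S then A $ i else B $ i) $ i $ p i) =
          (\<Prod>i\<in>UNIV. if i \<in> S then A $ i $ p i else B $ i $ p i)"
        by (rule prod.cong) auto
      also have "\<dots> = (\<Prod>i\<in>S. A $ i $ p i) * (\<Prod>i\<in>UNIV - S. B $ i $ p i)"
        by (subst prod.If_cases) (auto simp: Compl_eq_Diff_UNIV)
      finally show "(\<Prod>i\<in>S. A $ i $ p i) * (\<Prod>i\<in>UNIV - S. B $ i $ p i) =
          (\<Prod>i\<in>UNIV. (\<chi> i. if i \<in> S then A $ i else B $ i) $ i $ p i)" by simp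
    qed simp
    finally show ?thesis .
  qed
  show ?thesis
    unfolding det_def prod sum_distrib_left by (rule sum.swap)
qed

lemma det_scale_rows_columns:
  fixes K :: "'a::comm_ring_1^'n^'n"
  shows "det (\<chi> i j. a i * K $ i $ j * b j) = (\<Prod>i\<in>UNIV. a i) * (\<Prod>i\<in>UNIV. b i) * det K"
proof -
  have "(\<Prod>i\<in>UNIV. a i * K $ i $ p i * b (p i)) =
      (\<Prod>i\<in>UNIV. a i) * (\<Prod>i\<in>UNIV. b i) * (\<Prod>i\<in>UNIV. K $ i $ p i)"
    if "p permutes UNIV" for p
  proof -
    have "(\<Prod>i\<in>UNIV. b (p i)) = (\<Prod>i\<in>UNIV. b i)"
      using prod.permute[OF that, of b] by (simp add: o_def)
    then show ?thesis by (simp add: prod.distrib mult_ac)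
  qed
  then show ?thesis
    by (auto simp: det_def sum_distrib_left mult_ac intro!: sum.cong)
qed

text \<open>
  In the summand for \<open>S\<close>, row \<open>i\<close> can be scaled by \<open>exp (\<psi> $ i)\<close> if \<open>i \<in> S\<close> and by \<open>exp (- \<psi> $ i)\<close>
  otherwise, and column \<open>j\<close> by \<open>exp (\<psi> $ j)\<close>: on the rows outside \<open>S\<close>, which are supported on the
  diagonal, the two scalings cancel.
\<close>
lemma det_exp_scaled_plus_Diag:
  fixes M :: "real^'n^'n" and e \<psi> :: "real^'n"
  shows "det ((\<chi> i j. exp (\<psi> $ i) * M $ i $ j * exp (\<psi> $ j)) + Diag e) =
    (\<Sum>S\<in>UNIV. det (\<chi> i. if i \<in> S then M $ i else Diag e $ i) * exp (2 * (\<Sum>i\<in>S. \<psi> $ i)))"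
proof -
  have "det (\<chi> i. if i \<in> S then (\<chi> i j. exp (\<psi> $ i) * M $ i $ j * exp (\<psi> $ j)) $ i else Diag e $ i) =
      det (\<chi> i. if i \<in> S then M $ i else Diag e $ i) * exp (2 * (\<Sum>i\<in>S. \<psi> $ i))" for S
  proof -
    define a where "a i = (if i \<in> S then exp (\<psi> $ i) else exp (- \<psi> $ i))" for i
    have "(\<Prod>i\<in>UNIV. a i) * (\<Prod>i\<in>UNIV. exp (\<psi> $ i)) =
        (\<Prod>i\<in>UNIV. if i \<in> S then exp (2 * \<psi> $ i) else 1)"
      unfolding prod.distrib[symmetric] a_def by (rule prod.cong) (auto simp flip: exp_add)
    also have "\<dots> = exp (2 * (\<Sum>i\<in>S. \<psi> $ i))"
      by (simp add: prod.If_cases exp_sum sum_distrib_left)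
    finally have ab: "(\<Prod>i\<in>UNIV. a i) * (\<Prod>i\<in>UNIV. exp (\<psi> $ i)) = exp (2 * (\<Sum>i\<in>S. \<psi> $ i))" .
    have "(\<chi> i. if i \<in> S then (\<chi> i j. exp (\<psi> $ i) * M $ i $ j * exp (\<psi> $ j)) $ i else Diag e $ i) =
        (\<chi> i j. a i * (\<chi> i. if i \<in> S then M $ i else Diag e $ i) $ i $ j * exp (\<psi> $ j))"
      by (auto simp: vec_eq_iff a_def Diag_def exp_minus)
    then show ?thesis
      by (simp only: det_scale_rows_columns ab) (rule mult.commute)
  qed
  then show ?thesis
    by (simp only: det_add_rows)
qed


section \<open>Positive semidefinite matrices\<close>

text \<open>
  On the segment from the identity to the given matrix all matrices before the endpoint are
  invertible: a kernel vector must vanish outside \<open>S\<close>, and then semidefiniteness makes it vanish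
  on \<open>S\<close>. So the determinant, which is \<open>1\<close> at the identity, cannot change sign.
\<close>
lemma det_psd_rows_Diag_rows_nonneg:
  fixes M :: "real^'n^'n"
  assumes M: "psd M" and e: "\<And>i. 0 \<le> e $ i"
  shows "0 \<le> det (\<chi> i. if i \<in> S then M $ i else Diag e $ i)"
proof (rule ccontr)
  define K where "K = (\<chi> i. if i \<in> S then M $ i else Diag e $ i)"
  define H where "H t = (1 - t) *\<^sub>R mat 1 + t *\<^sub>R K" for t
  have H_cont: "continuous_on {0..1} (\<lambda>t. det (H t))"
    unfolding det_def H_def
    by (simp only: vector_add_component vector_scaleR_component) (intro continuous_intros)
  assume "\<not> 0 \<le> det (\<chi> i. if i \<in> S then M $ i else Diag e $ i)"
  then have neg: "det (H 1) < 0" by (simp add: H_def K_def)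
  have "\<exists>t\<ge>0. t \<le> 1 \<and> det (H t) = 0"
    using neg H_cont by (intro IVT2') (auto simp: H_def)
  then obtain t where t: "0 \<le> t" "t \<le> 1" "det (H t) = 0" by blast
  with neg have t1: "t < 1" by (cases "t = 1") auto
  have "\<not> invertible (H t)"
    using t(3) by (simp add: invertible_det_nz)
  then obtain v where v: "H t *v v = 0" "v \<noteq> 0"
    by (metis invertible_left_inverse matrix_left_invertible_ker)
  have row: "(1 - t) * v $ i + t * (K *v v) $ i = 0" for i
  proof -
    have "H t *v v = (1 - t) *\<^sub>R v + t *\<^sub>R (K *v v)"
      by (simp add: H_def matrix_vector_mult_add_rdistrib flip: scaleR_matrix_vector_assoc)
    then show ?thesis using v(1) by (metis vector_add_component vector_scaleR_component
        zero_index real_scaleR_def)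
  qed
  have out: "v $ i = 0" if "i \<notin> S" for i
  proof -
    have "(K *v v) $ i = e $ i * v $ i"
      using that by (simp add: K_def matrix_vector_mult_def Diag_def if_distrib[of "\<lambda>x. x * _"] cong: if_cong)
    with row[of i] have "((1 - t) + t * e $ i) * v $ i = 0" by (simp add: algebra_simps)
    moreover have "0 < (1 - t) + t * e $ i" using t1 t(1) e[of i] by (simp add: add_pos_nonneg)
    ultimately show ?thesis by simp
  qed
  have "v $ i * ((1 - t) * v $ i + t * (M *v v) $ i) = 0" for i
  proof (cases "i \<in> S")
    case True
    then have "(K *v v) $ i = (M *v v) $ i" by (simp add: K_def matrix_vector_mult_def)
    then show ?thesis using row[of i] by simp
  qed (simp add: out)
  then have "(\<Sum>i\<in>UNIV. v $ i * ((1 - t) * v $ i + t * (M *v v) $ i)) = 0"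
    by (rule sum.neutral[OF ballI])
  then have "(1 - t) * (v \<bullet> v) + t * (v \<bullet> (M *v v)) = 0"
    by (simp add: inner_vec_def sum.distrib sum_distrib_left algebra_simps sum_subtractf)
  moreover have "0 < (1 - t) * (v \<bullet> v)" "0 \<le> t * (v \<bullet> (M *v v))"
    using t1 t(1) v(2) M by (auto simp: psd_def)
  ultimately show False by linarith
qed

lemma psd_add: "psd M \<Longrightarrow> psd N \<Longrightarrow> psd (M + N)"
  by (auto simp: psd_def transpose_def vec_eq_iff matrix_vector_mult_add_rdistrib inner_add_right)

lemma psd_scaleR: "0 \<le> r \<Longrightarrow> psd M \<Longrightarrow> psd (r *\<^sub>R M)"
  by (auto simp: psd_def transpose_def vec_eq_iff inner_scaleR_right
      simp flip: scaleR_matrix_vector_assoc)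

lemma quadratic_form_outer: "v \<bullet> (outer c *v v) = (v \<bullet> c)\<^sup>2" for v c :: "real^'n"
  unfolding quadratic_form_sum
  by (simp add: outer_def inner_vec_def power2_eq_square sum_product mult_ac)

lemma psd_outer: "psd (outer c)"
  unfolding psd_def quadratic_form_outer by (simp add: outer_def transpose_def vec_eq_iff mult.commute)

lemma psd_outer_hadamard:
  assumes "psd X"
  shows "psd (outer c \<circ>\<^sub>H X)"
proof -
  have "v \<bullet> ((outer c \<circ>\<^sub>H X) *v v) = (\<chi> i. c $ i * v $ i) \<bullet> (X *v (\<chi> i. c $ i * v $ i))" for v
    by (simp add: quadratic_form_sum outer_def hadamard_def mult_ac)
  then show ?thesis
    using assms by (auto simp: psd_def transpose_def vec_eq_iff outer_def hadamard_def mult_ac)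
qed

lemma psd_diag_nonneg:
  assumes "psd M"
  shows "0 \<le> M $ i $ i"
proof -
  have "0 \<le> axis i 1 \<bullet> (M *v axis i 1)" using assms unfolding psd_def by blast
  also have "\<dots> = M $ i $ i"
    by (simp add: matrix_vector_mult_basis column_def inner_axis')
  finally show ?thesis .
qed

text \<open>Minimise the quadratic form along the line through \<open>v\<close> in direction \<open>i\<close>.\<close>
lemma psd_row_square_le:
  fixes M :: "real^'n^'n"
  assumes M: "psd M"
  shows "(v \<bullet> M $ i)\<^sup>2 \<le> M $ i $ i * (v \<bullet> (M *v v))"
proof -
  let ?r = "v \<bullet> M $ i"
  have sym: "M $ j $ k = M $ k $ j" for j k
    using M by (auto simp: psd_def transpose_def vec_eq_iff)
  have col: "M *v axis i 1 = M $ i"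
    unfolding matrix_vector_mult_basis column_def vec_eq_iff by (metis sym vec_lambda_beta)
  have vi: "(M *v v) $ i = ?r"
    by (simp add: matrix_vector_mul_component inner_commute)
  have q: "0 \<le> v \<bullet> (M *v v) + 2 * t * ?r + t * t * M $ i $ i" for t
  proof -
    have "(v + t *\<^sub>R axis i 1) \<bullet> (M *v (v + t *\<^sub>R axis i 1)) =
        v \<bullet> (M *v v) + 2 * t * ?r + t * t * M $ i $ i"
      by (simp add: matrix_vector_right_distrib matrix_vector_mult_scaleR inner_add_left
          inner_add_right inner_axis' col vi algebra_simps)
    then show ?thesis using M by (metis psd_def)
  qed
  have pos: "0 \<le> M $ i $ i"
    using M by (rule psd_diag_nonneg)
  show ?thesis
  proof (cases "M $ i $ i = 0")
    case True
    have "?r = 0"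
    proof (rule ccontr)
      assume r: "?r \<noteq> 0"
      \<comment> \<open>The form is affine on this line, so some point has the value \<open>-1\<close>.\<close>
      show False
        using q[of "- (v \<bullet> (M *v v) + 1) / (2 * ?r)"] True r by (simp add: field_simps)
    qed
    then show ?thesis using True by simp
  next
    case False
    with pos have p: "0 < M $ i $ i" by simp
    have "0 \<le> M $ i $ i * (v \<bullet> (M *v v) + 2 * (- ?r / M $ i $ i) * ?r
        + (- ?r / M $ i $ i) * (- ?r / M $ i $ i) * M $ i $ i)"
      using q[of "- ?r / M $ i $ i"] p by simp
    also have "\<dots> = M $ i $ i * (v \<bullet> (M *v v)) - ?r\<^sup>2"
      using p by (simp add: field_simps power2_eq_square)
    finally show ?thesis by simp
  qed
qed

text \<open>
  Gaussian elimination: subtracting the rank-one matrix built from row \<open>i\<close> clears that row and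
  leaves a semidefinite Schur complement; a row with zero pivot vanishes already. For a rank-one
  matrix the product is the congruence of \<open>X\<close> by a diagonal matrix, so the claim follows by
  induction on a set that contains all nonzero rows.
\<close>
theorem Schur_product_psd:
  fixes M X :: "real^'n^'n"
  assumes "psd M" and X: "psd X"
  shows "psd (M \<circ>\<^sub>H X)"
proof -
  have "psd (M \<circ>\<^sub>H X)" if "finite T" "psd M" "\<And>i. i \<notin> T \<Longrightarrow> M $ i = 0" for T and M :: "real^'n^'n"
    using that
  proof (induction T arbitrary: M rule: finite_induct)
    case empty
    then have "M \<circ>\<^sub>H X = 0" by (simp add: hadamard_def vec_eq_iff)
    moreover have "psd 0" by (simp add: psd_def transpose_def zero_vec_def quadratic_form_sum)
    ultimately show ?case by simp
  next
    case (insert i T M)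
    have sym: "M $ j $ k = M $ k $ j" for j k
      using insert.prems(1) by (auto simp: psd_def transpose_def vec_eq_iff)
    have row: "(v \<bullet> M $ i)\<^sup>2 \<le> M $ i $ i * (v \<bullet> (M *v v))" for v
      using insert.prems(1) by (rule psd_row_square_le)
    show ?case
    proof (cases "M $ i $ i = 0")
      case True
      have "M $ i = 0" using row[of "M $ i"] True by simp
      then have "M $ k = 0" if "k \<notin> T" for k using insert.prems(2)[of k] that by (cases "k = i") auto
      then show ?thesis using insert.IH insert.prems(1) by blast
    next
      case False
      have "0 \<le> M $ i $ i"
        using insert.prems(1) by (rule psd_diag_nonneg)
      with False have p: "0 < M $ i $ i" by simp
      define R where "R = (1 / M $ i $ i) *\<^sub>R outer (M $ i)"
      have R: "R $ j $ k = M $ i $ j * M $ i $ k / M $ i $ i" for j k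
        by (simp add: R_def outer_def)
      have "psd (M - R)"
      proof -
        have "v \<bullet> ((M - R) *v v) = v \<bullet> (M *v v) - (v \<bullet> M $ i)\<^sup>2 / M $ i $ i" for v
          by (simp add: matrix_vector_mult_diff_rdistrib inner_diff_right R_def
              quadratic_form_outer flip: scaleR_matrix_vector_assoc)
        moreover have "(v \<bullet> M $ i)\<^sup>2 / M $ i $ i \<le> v \<bullet> (M *v v)" for v
          using row[of v] p by (simp add: field_simps)
        moreover have "transpose (M - R) = M - R"
          by (simp add: transpose_def vec_eq_iff R sym mult.commute)
        ultimately show ?thesis by (simp add: psd_def)
      qed
      moreover have "(M - R) $ k = 0" if "k \<notin> T" for k
      proof (cases "k = i")
        case True
        then show ?thesis using p by (simp add: vec_eq_iff R)
      next
        case False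
        then have "M $ k = 0" using that insert.prems(2) by auto
        then show ?thesis using sym[of i k] by (simp add: vec_eq_iff R)
      qed
      ultimately have "psd ((M - R) \<circ>\<^sub>H X)" using insert.IH by blast
      moreover have "psd ((1 / M $ i $ i) *\<^sub>R (outer (M $ i) \<circ>\<^sub>H X))"
        using p by (intro psd_scaleR psd_outer_hadamard X) simp
      moreover have "M \<circ>\<^sub>H X = (M - R) \<circ>\<^sub>H X + (1 / M $ i $ i) *\<^sub>R (outer (M $ i) \<circ>\<^sub>H X)"
        by (simp add: vec_eq_iff hadamard_def R outer_def algebra_simps)
      ultimately show ?thesis using psd_add by metis
    qed
  qed
  from this[of UNIV M] assms(1) show ?thesis by simp
qed


section \<open>Convexity\<close>

text \<open>
  Divide by the weighted geometric mean \<open>exp (u * ln f + v * ln g)\<close> of the two sums \<open>f\<close> and \<open>g\<close>;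
  convexity of \<open>exp\<close>, applied termwise, bounds the quotient by \<open>u + v = 1\<close>.
\<close>
lemma sum_exp_log_convex:
  fixes a b c :: "'i \<Rightarrow> real"
  assumes c: "\<And>k. k \<in> I \<Longrightarrow> 0 \<le> c k" and uv: "0 \<le> u" "0 \<le> v" "u + v = 1"
    and F: "0 < (\<Sum>k\<in>I. c k * exp (a k))" and G: "0 < (\<Sum>k\<in>I. c k * exp (b k))"
  shows "(\<Sum>k\<in>I. c k * exp (u * a k + v * b k)) \<le>
    exp (u * ln (\<Sum>k\<in>I. c k * exp (a k)) + v * ln (\<Sum>k\<in>I. c k * exp (b k)))"
proof -
  define f g where "f = (\<Sum>k\<in>I. c k * exp (a k))" and "g = (\<Sum>k\<in>I. c k * exp (b k))"
  define E where "E = exp (u * ln f + v * ln g)"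
  have f: "0 < f" and g: "0 < g" using F G by (simp_all add: f_def g_def)
  have "exp (u * a k + v * b k) \<le> E * (u * (exp (a k) / f) + v * (exp (b k) / g))" for k
  proof -
    have "exp (u * (a k - ln f) + v * (b k - ln g)) \<le>
        u * exp (a k - ln f) + v * exp (b k - ln g)"
      using exp_convex uv by (simp add: convex_on_def)
    then have "exp (u * (a k - ln f) + v * (b k - ln g)) \<le>
        u * (exp (a k) / f) + v * (exp (b k) / g)"
      using f g by (simp add: exp_diff)
    then have "E * exp (u * (a k - ln f) + v * (b k - ln g)) \<le>
        E * (u * (exp (a k) / f) + v * (exp (b k) / g))"
      by (rule mult_left_mono) (simp add: E_def)
    moreover have "exp (u * a k + v * b k) = E * exp (u * (a k - ln f) + v * (b k - ln g))"
      by (simp add: E_def algebra_simps flip: exp_add)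
    ultimately show ?thesis by simp
  qed
  then have "(\<Sum>k\<in>I. c k * exp (u * a k + v * b k)) \<le>
      (\<Sum>k\<in>I. c k * (E * (u * (exp (a k) / f) + v * (exp (b k) / g))))"
    by (intro sum_mono mult_left_mono c)
  also have "\<dots> = E * (u * ((\<Sum>k\<in>I. c k * exp (a k)) / f) + v * ((\<Sum>k\<in>I. c k * exp (b k)) / g))"
    by (simp add: sum.distrib sum_distrib_left sum_divide_distrib algebra_simps)
  also have "\<dots> = E" using f g uv by (simp flip: f_def g_def)
  finally show ?thesis by (simp add: E_def f_def g_def)
qed

lemma ereal_convex_on_SUP:
  assumes "convex S" and "\<And>p. p \<in> I \<Longrightarrow> ereal_convex_on S (f p)"
  shows "ereal_convex_on S (\<lambda>x. SUP p\<in>I. f p x)"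
  unfolding ereal_convex_on_def
proof (intro conjI ballI allI impI)
  fix x y and u v :: real
  assume xy: "x \<in> S" "y \<in> S" and uv: "0 \<le> u" "0 \<le> v" "u + v = 1"
  show "(SUP p\<in>I. f p (u *\<^sub>R x + v *\<^sub>R y)) \<le> ereal u * (SUP p\<in>I. f p x) + ereal v * (SUP p\<in>I. f p y)"
  proof (rule SUP_least)
    fix p assume p: "p \<in> I"
    have "f p (u *\<^sub>R x + v *\<^sub>R y) \<le> ereal u * f p x + ereal v * f p y"
      using assms(2)[OF p] xy uv unfolding ereal_convex_on_def by blast
    also have "\<dots> \<le> ereal u * (SUP p\<in>I. f p x) + ereal v * (SUP p\<in>I. f p y)"
      using p uv by (intro add_mono ereal_mult_left_mono SUP_upper) auto
    finally show "f p (u *\<^sub>R x + v *\<^sub>R y) \<le> \<dots>" .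
  qed
qed (rule assms(1))

lemma f_BQP_convex_in_log_scaling:
  fixes C X :: "real^'n^'n" and x :: "real^'n"
  assumes C: "psd C" and X: "psd X" and x: "\<And>i. x $ i \<le> 1"
  shows "ereal_convex_on UNIV (\<lambda>\<psi>. f_BQP C x X (\<chi> i. exp (\<psi> $ i)))"
proof -
  define c where "c S = det (\<chi> i. if i \<in> S then (C \<circ>\<^sub>H X) $ i else Diag (1 - x) $ i)" for S
  define F where "F \<psi> = (\<Sum>S\<in>UNIV. c S * exp (2 * (\<Sum>i\<in>S. \<psi> $ i)))" for \<psi> :: "real^'n"
  have c: "0 \<le> c S" for S
    unfolding c_def using x by (intro det_psd_rows_Diag_rows_nonneg Schur_product_psd C X) simp
  have f: "f_BQP C x X (\<chi> i. exp (\<psi> $ i)) =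
      (if F \<psi> > 0 then ereal (ln (F \<psi>)) else -\<infinity>) - ereal (2 * (x \<bullet> \<psi>))" for \<psi>
  proof -
    have "Diag (\<chi> i. exp (\<psi> $ i)) ** C ** Diag (\<chi> i. exp (\<psi> $ i)) \<circ>\<^sub>H X =
        (\<chi> i j. exp (\<psi> $ i) * (C \<circ>\<^sub>H X) $ i $ j * exp (\<psi> $ j))"
      by (simp add: vec_eq_iff hadamard_def matrix_matrix_mult_def Diag_def mult_ac
          if_distrib[of "\<lambda>x. x * _"] if_distrib[of "\<lambda>x. _ * x"] cong: if_cong)
    then have "det (Diag (\<chi> i. exp (\<psi> $ i)) ** C ** Diag (\<chi> i. exp (\<psi> $ i)) \<circ>\<^sub>H X + Diag (1 - x)) = F \<psi>"
      by (simp only: det_exp_scaled_plus_Diag F_def c_def)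
    then show ?thesis
      by (simp add: f_BQP_def ldet_def inner_vec_def)
  qed
  have "f_BQP C x X (\<chi> i. exp ((u *\<^sub>R \<psi> + v *\<^sub>R \<phi>) $ i)) \<le>
      ereal u * f_BQP C x X (\<chi> i. exp (\<psi> $ i)) + ereal v * f_BQP C x X (\<chi> i. exp (\<phi> $ i))"
    if uv: "0 \<le> u" "0 \<le> v" "u + v = 1" for \<psi> \<phi> :: "real^'n" and u v
  proof (cases "F (u *\<^sub>R \<psi> + v *\<^sub>R \<phi>) > 0")
    case True
    \<comment> \<open>Positivity of \<open>F\<close> at one point means that some coefficient is nonzero,
      and then \<open>F\<close> is positive everywhere.\<close>
    have "\<exists>S. c S \<noteq> 0"
    proof (rule ccontr)
      assume "\<nexists>S. c S \<noteq> 0"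
      then show False using True by (simp add: F_def)
    qed
    then obtain S where "c S \<noteq> 0" ..
    then have S: "0 < c S" using c[of S] by simp
    have pos: "0 < F \<xi>" for \<xi>
      unfolding F_def by (rule sum_pos2[of _ S]) (use S c in auto)
    have lin: "2 * (\<Sum>i\<in>S. (u *\<^sub>R \<psi> + v *\<^sub>R \<phi>) $ i) =
        u * (2 * (\<Sum>i\<in>S. \<psi> $ i)) + v * (2 * (\<Sum>i\<in>S. \<phi> $ i))" for S
      by (simp add: sum.distrib sum_distrib_left algebra_simps)
    have "F (u *\<^sub>R \<psi> + v *\<^sub>R \<phi>) \<le> exp (u * ln (F \<psi>) + v * ln (F \<phi>))"
      using pos[of \<psi>] pos[of \<phi>] c uv unfolding F_def lin by (intro sum_exp_log_convex) auto
    then have "ln (F (u *\<^sub>R \<psi> + v *\<^sub>R \<phi>)) \<le> u * ln (F \<psi>) + v * ln (F \<phi>)"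
      using True by (metis ln_exp ln_le_cancel_iff exp_gt_zero)
    then show ?thesis
      by (simp only: f pos if_True inner_add_right inner_scaleR_right) (simp add: algebra_simps)
  next
    case False
    then show ?thesis by (simp only: f) simp
  qed
  then show ?thesis by (simp add: ereal_convex_on_def)
qed

lemma P_set_psd:
  assumes "(x, X) \<in> P_set s"
  shows "psd X"
proof -
  have "psd ((X - outer x) + outer x)"
    using assms by (intro psd_add psd_outer) (simp add: P_set_def)
  then show ?thesis by simp
qed

theorem theorem1:
  fixes C :: "real^'n^'n" and s m :: nat
    and A :: "nat \<Rightarrow> real^'n" and b :: "nat \<Rightarrow> real"
  assumes "CARD('n) > 1" and "0 < s" and "s < CARD('n)"
    and "psd C" and "rank C \<ge> s"
  shows "ereal_convex_on UNIV (\<lambda>\<psi>. z_BQP C s m A b (\<chi> i. exp (\<psi> $ i)))"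
  unfolding z_BQP_def
proof (rule ereal_convex_on_SUP[OF convex_UNIV])
  fix p assume "p \<in> feasible s m A b"
  then obtain x X where p: "p = (x, X)" "(x, X) \<in> P_set s"
    by (auto simp: feasible_def)
  show "ereal_convex_on UNIV
      (\<lambda>\<psi>. case p of (x, X) \<Rightarrow> f_BQP C x X (\<chi> i. exp (\<psi> $ i)))"
    using f_BQP_convex_in_log_scaling[OF assms(4) P_set_psd[OF p(2)] P_set_bounds(2)[OF p(2)]]
    by (simp add: p(1))
qed

end
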